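(* Let $\phi\in DB(I)$, that is, $\phi(y)=\phi(x)+\int_x^y f(u)\,du$ for $y\in I$, with $f\in B(I)$, and let $g=f_x$ be the function associated to $f$. Then, for every $n\in\mathbb{N}$, $$\left|L_n(\phi,x)-\phi(x)-\frac{1}{2\sqrt{n}}(f(x+)+f(x-))\,\mathbb{E}Z_n(x)-\frac{1}{2\sqrt{n}}(f(x+)-f(x-))\,\mathbb{E}|Z_n(x)|\right|\leq \frac{C_n(\beta)}{\beta\sqrt{n}}\,\mathbb{E}\,\omega\left(g,\frac{X_{\beta}}{\sqrt{n}}\right).$$
   Context: $\mathbb{N}$ is the set of positive integers, $I$ is a real interval, and $x$ is a fixed point of the interior of $I$. $B(I)$ is the set of all measurable bounded functions $f:I\to\mathbb{R}$ whose right and left limits at $x$, denoted $f(x+)$ and $f(x-)$, exist and are finite. $DB(I)$ is the set of absolutely continuous functions $\phi$ of the form $\phi(y)=\phi(x)+\int_x^y f(u)\,du$, $y\in I$, with $f\in B(I)$. For $f\in B(I)$, its associated function $g=f_x$ is $$f_x(y)=(f(y)-f(x+))1_{I\cap(x,\infty)}(y)+(f(y)-f(x-))1_{I\cap(-\infty,x)}(y),\quad y\in I,$$ where $1_A$ is the indicator function of $A$; in particular $g(x)=0$. The local first modulus of continuity of $g$ at $x$ is $$\omega(g,\theta)=\sup\{|g(x+u)-g(x)|:\ x+u\in I,\ |u|\leq\theta\},\quad \theta\geq 0.$$ For each $n\in\mathbb{N}$, $Z_n(x)$ is a real random variable such that $x+Z_n(x)/\sqrt{n}$ takes values in $I$,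 and the positive linear operator $L_n$ is given by $$L_n(h,x)=\mathbb{E}\, h\left(x+\frac{Z_n(x)}{\sqrt{n}}\right)$$ for measurable $h:I\to\mathbb{R}$ for which the expectation is finite. Standing assumptions: there are positive constants $\beta$ and $C_n(\beta)$ (possibly depending on $x$) such that for all $n\in\mathbb{N}$ $$P(|Z_n(x)|\geq\theta)\leq C_n(\beta)\exp(-\beta\theta),\quad \theta\geq 0,$$ and $\lim_{n\to\infty}P(Z_n(x)>0)=\lim_{n\to\infty}P(Z_n(x)<0)=\frac12$. $X_\beta$ is a random variable with the exponential distribution of parameter $\beta$, i.e. $P(X_\beta\leq y)=1-\exp(-\beta y)$ for $y\geq 0$. *)

theory Defs
  imports "HOL-Probability.Probability"
begin

text \<open>
  Throughout, \<open>I\<close> is a real interval and \<open>x\<close> a point of its interior.  Functions on \<open>I\<close> are total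
  functions on the reals whose values outside \<open>I\<close> are irrelevant; since \<open>x\<close> is interior, the
  one-sided limits at \<open>x\<close> only see values on \<open>I\<close>.
\<close>

abbreviation right_lim :: "(real \<Rightarrow> real) \<Rightarrow> real \<Rightarrow> real" where
  "right_lim f x \<equiv> Lim (at_right x) f"

abbreviation left_lim :: "(real \<Rightarrow> real) \<Rightarrow> real \<Rightarrow> real" where
  "left_lim f x \<equiv> Lim (at_left x) f"

text \<open>``Measurable'' is read as Lebesgue measurable on \<open>I\<close>, which includes the Borel functions.\<close>

definition B_space :: "real set \<Rightarrow> real \<Rightarrow> (real \<Rightarrow> real) set" where
  "B_space I x = {f. f \<in> borel_measurable (lebesgue_on I) \<and> bounded (f ` I) \<and>
     (\<exists>l. (f \<longlongrightarrow> l) (at_right x)) \<and> (\<exists>l. (f \<longlongrightarrow> l) (at_left x))}"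

definition abs_cont_on :: "real set \<Rightarrow> (real \<Rightarrow> real) \<Rightarrow> bool" where
  "abs_cont_on I \<phi> \<longleftrightarrow>
     (\<forall>\<epsilon>>0. \<exists>\<delta>>0. \<forall>(m::nat) a b.
        (\<forall>k<m. a k \<in> I \<and> b k \<in> I \<and> a k \<le> b k) \<longrightarrow>
        disjoint_family_on (\<lambda>k. {a k<..<b k}) {..<m} \<longrightarrow>
        (\<Sum>k<m. b k - a k) < \<delta> \<longrightarrow>
        (\<Sum>k<m. \<bar>\<phi> (b k) - \<phi> (a k)\<bar>) < \<epsilon>)"

text \<open>The interval integral is oriented: for \<open>y < x\<close> it is minus the integral over \<open>(y, x)\<close>.\<close>

definition is_primitive :: "real set \<Rightarrow> real \<Rightarrow> (real \<Rightarrow> real) \<Rightarrow> (real \<Rightarrow> real) \<Rightarrow> bool" where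
  "is_primitive I x f \<phi> \<longleftrightarrow>
     (\<forall>y\<in>I. \<phi> y = \<phi> x + interval_lebesgue_integral lebesgue (ereal x) (ereal y) f)"

text \<open>
  Absolute continuity is automatic for the primitive of a bounded function (which is Lipschitz);
  it is listed to follow the usual description of the space.
\<close>

definition DB_space :: "real set \<Rightarrow> real \<Rightarrow> (real \<Rightarrow> real) set" where
  "DB_space I x = {\<phi>. abs_cont_on I \<phi> \<and> (\<exists>f\<in>B_space I x. is_primitive I x f \<phi>)}"

definition assoc_fun :: "real set \<Rightarrow> real \<Rightarrow> (real \<Rightarrow> real) \<Rightarrow> real \<Rightarrow> real" where
  "assoc_fun I x f y =
     (f y - right_lim f x) * indicator (I \<inter> {x<..}) y +
     (f y - left_lim f x) * indicator (I \<inter> {..<x}) y"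

definition local_modulus :: "real set \<Rightarrow> real \<Rightarrow> (real \<Rightarrow> real) \<Rightarrow> real \<Rightarrow> real" where
  "local_modulus I x g \<theta> = Sup {\<bar>g (x + u) - g x\<bar> | u. x + u \<in> I \<and> \<bar>u\<bar> \<le> \<theta>}"

text \<open>\<open>Z n x\<close> is a random variable on its own probability space \<open>M n\<close>; no joint law is assumed.\<close>

definition L_op ::
  "(nat \<Rightarrow> 'a measure) \<Rightarrow> (nat \<Rightarrow> real \<Rightarrow> 'a \<Rightarrow> real) \<Rightarrow> nat \<Rightarrow> (real \<Rightarrow> real) \<Rightarrow> real \<Rightarrow> real" where
  "L_op M Z n h x = (\<integral>\<omega>. h (x + Z n x \<omega> / sqrt (real n)) \<partial>M n)"

end

theory Submission
  imports Defs
begin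

text \<open>
  Write \<open>Y = x + Z\<^sub>n(x) / \<surd>n\<close>, \<open>a = f(x+)\<close> and \<open>b = f(x-)\<close>.  On the right of \<open>x\<close> one has
  \<open>f = a + g\<close>, on the left \<open>f = b + g\<close>.  Integrating from \<open>x\<close> to \<open>y\<close>, the constants contribute
  \<open>a (y - x)\<close> if \<open>y \<ge> x\<close> and \<open>b (y - x)\<close> if \<open>y \<le> x\<close>, which is in both cases
  \<open>(a + b)/2 (y - x) + (a - b)/2 \<bar>y - x\<bar>\<close>; these are the two correction terms of the theorem once
  \<open>y = Y\<close> and expectations are taken.  What is left is the oriented integral of \<open>g\<close> from \<open>x\<close> to
  \<open>y\<close>.  As \<open>g(x) = 0\<close>, the value of \<open>\<bar>g\<bar>\<close> at distance \<open>t\<close> from \<open>x\<close> is at most \<open>\<omega>(g, t)\<close>, so the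
  remainder is at most \<open>\<integral>\<^sub>0 \<omega>(g, t) dt\<close> with upper end \<open>\<bar>y - x\<bar>\<close> (lemma
  \<open>primitive_expansion_remainder\<close>).

  It remains to bound the expectation of this integral with random upper end \<open>\<bar>Y - x\<bar>\<close>.  By Tonelli
  it equals \<open>\<integral>\<^sub>0\<^sup>\<infinity> \<omega>(g, t) P(\<bar>Y - x\<bar> > t) dt\<close>.  The assumed tail of \<open>Z\<^sub>n(x)\<close> says that
  \<open>P(\<bar>Y - x\<bar> \<ge> t) \<le> C\<^sub>n(\<beta>) exp(- \<beta> \<surd>n t)\<close>, and the right-hand side is
  \<open>C\<^sub>n(\<beta>) / (\<beta> \<surd>n)\<close> times the density of the exponential law of parameter \<open>\<beta> \<surd>n\<close> (lemma
  \<open>exponential_tail_integral\<close>), which is the law of \<open>X\<^sub>\<beta> / \<surd>n\<close> (lemma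
  \<open>distributed_exponential_divide\<close>).  This is the asserted bound.
\<close>

section \<open>Tail bounds and the exponential law\<close>

text \<open>
  Exchange the integrals: for fixed \<open>t\<close> the integrand contributes \<open>W t\<close> times \<open>P(Y > t)\<close>.  An
  exponential tail bound is a multiple of an exponential density, which turns the remaining integral
  into an expectation under the exponential law.  Stated with values in \<open>ennreal\<close>, the lemma
  yields integrability as well as estimates.
\<close>

lemma exponential_tail_integral:
  fixes Y :: "'a \<Rightarrow> real" and W :: "real \<Rightarrow> ennreal"
  assumes "finite_measure M" and [measurable]: "Y \<in> borel_measurable M"
    and [measurable]: "W \<in> borel_measurable borel"
    and "b > 0" and "c \<ge> 0"
    and tail: "\<And>t. t \<ge> 0 \<Longrightarrow> measure M {\<omega> \<in> space M. t \<le> Y \<omega>} \<le> c * exp (- b * t)"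
  shows "(\<integral>\<^sup>+\<omega>. (\<integral>\<^sup>+t. W t * indicator {0<..<Y \<omega>} t \<partial>lborel) \<partial>M)
    \<le> ennreal (c / b) * (\<integral>\<^sup>+t. exponential_density b t * W t \<partial>lborel)"
proof -
  interpret M: finite_measure M by fact
  interpret P: pair_sigma_finite lborel M ..
  have "(\<integral>\<^sup>+\<omega>. (\<integral>\<^sup>+t. W t * indicator {0<..<Y \<omega>} t \<partial>lborel) \<partial>M)
    = (\<integral>\<^sup>+\<omega>. (\<integral>\<^sup>+t. W t * indicator {0<..} t * of_bool (t < Y \<omega>) \<partial>lborel) \<partial>M)"
    by (intro nn_integral_cong) (auto simp: indicator_def)
  also have "\<dots> = (\<integral>\<^sup>+t. (\<integral>\<^sup>+\<omega>. W t * indicator {0<..} t * of_bool (t < Y \<omega>) \<partial>M) \<partial>lborel)"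
    by (rule P.Fubini') measurable
  also have "\<dots> \<le> (\<integral>\<^sup>+t. ennreal (c / b) * (exponential_density b t * W t) \<partial>lborel)"
  proof (intro nn_integral_mono)
    fix t :: real
    have "(\<integral>\<^sup>+\<omega>. of_bool (t < Y \<omega>) \<partial>M) = (\<integral>\<^sup>+\<omega>. indicator {\<omega> \<in> space M. t < Y \<omega>} \<omega> \<partial>M)"
      by (intro nn_integral_cong) (auto simp: indicator_def)
    also have "\<dots> = emeasure M {\<omega> \<in> space M. t < Y \<omega>}"
      by (rule nn_integral_indicator) measurable
    also have "\<dots> \<le> emeasure M {\<omega> \<in> space M. t \<le> Y \<omega>}"
      by (rule emeasure_mono) auto
    also have "\<dots> \<le> ennreal (c * exp (- b * t))" if "t > 0"
      using tail[of t] that by (simp add: M.emeasure_eq_measure ennreal_leI)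
    finally have p: "(\<integral>\<^sup>+\<omega>. of_bool (t < Y \<omega>) \<partial>M) \<le> ennreal (c * exp (- b * t))" if "t > 0"
      using that by simp
    have "(\<integral>\<^sup>+\<omega>. W t * indicator {0<..} t * of_bool (t < Y \<omega>) \<partial>M)
        = W t * indicator {0<..} t * (\<integral>\<^sup>+\<omega>. of_bool (t < Y \<omega>) \<partial>M)"
      by (rule nn_integral_cmult) measurable
    also have "\<dots> \<le> ennreal (c / b) * (exponential_density b t * W t)"
    proof (cases "t > 0")
      case True
      have "ennreal (c / b) * ennreal (exponential_density b t) = ennreal (c * exp (- b * t))"
        using True \<open>b > 0\<close> \<open>c \<ge> 0\<close>
        by (subst ennreal_mult[symmetric]) (auto simp: exponential_density_def mult.commute)
      then show ?thesis
        using mult_left_mono[OF p[OF True], of "W t"] True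
        by (simp add: mult.assoc[symmetric] mult.commute[of "ennreal (c / b) * _"])
          (simp add: mult.commute)
    qed simp
    finally show "(\<integral>\<^sup>+\<omega>. W t * indicator {0<..} t * of_bool (t < Y \<omega>) \<partial>M)
      \<le> ennreal (c / b) * (exponential_density b t * W t)" .
  qed
  also have "\<dots> = ennreal (c / b) * (\<integral>\<^sup>+t. exponential_density b t * W t \<partial>lborel)"
    by (rule nn_integral_cmult) measurable
  finally show ?thesis .
qed

text \<open>The choice \<open>W = 1\<close> above gives the bound \<open>c / b\<close> for the mean of \<open>Y\<close>.\<close>

lemma exponential_tail_imp_integrable:
  fixes Y :: "'a \<Rightarrow> real"
  assumes "finite_measure M" and [measurable]: "Y \<in> borel_measurable M"
    and "\<And>\<omega>. \<omega> \<in> space M \<Longrightarrow> Y \<omega> \<ge> 0"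
    and "b > 0" and "c \<ge> 0"
    and tail: "\<And>t. t \<ge> 0 \<Longrightarrow> measure M {\<omega> \<in> space M. t \<le> Y \<omega>} \<le> c * exp (- b * t)"
  shows "integrable M Y"
proof (rule integrableI_nonneg)
  interpret E: prob_space "density lborel (exponential_density b)"
    using \<open>b > 0\<close> by (rule prob_space_exponential_density)
  have "(\<integral>\<^sup>+\<omega>. ennreal (Y \<omega>) \<partial>M) = (\<integral>\<^sup>+\<omega>. (\<integral>\<^sup>+t. 1 * indicator {0<..<Y \<omega>} t \<partial>lborel) \<partial>M)"
    using assms(3) by (intro nn_integral_cong) simp
  also have "\<dots> \<le> ennreal (c / b) * (\<integral>\<^sup>+t. ennreal (exponential_density b t) * 1 \<partial>lborel)"
    by (rule exponential_tail_integral) (use assms in auto)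
  also have "(\<integral>\<^sup>+t. ennreal (exponential_density b t) * 1 \<partial>lborel) = 1"
    using E.emeasure_space_1 by (simp add: emeasure_density)
  finally show "(\<integral>\<^sup>+\<omega>. ennreal (Y \<omega>) \<partial>M) < \<infinity>"
    using less_top by (auto simp: le_less_trans)
qed (use assms in auto)

lemma distributed_exponential_divide:
  assumes "prob_space N" "distributed N lborel X (exponential_density \<beta>)" and "\<beta> > 0" and "s > 0"
  shows "distributed N lborel (\<lambda>\<omega>. X \<omega> / s) (exponential_density (\<beta> * s))"
proof -
  interpret prob_space N by fact
  have "exponential_density \<beta> (t * s) / \<bar>1 / s\<bar> = exponential_density (\<beta> * s) t" for t
    using \<open>s > 0\<close> by (auto simp: exponential_density_def mult_less_0_iff)
  then have "ennreal (exponential_density \<beta> (t * s)) / ennreal \<bar>1 / s\<bar>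
      = ennreal (exponential_density (\<beta> * s) t)" for t
    using \<open>\<beta> > 0\<close> \<open>s > 0\<close> by (subst divide_ennreal) (auto simp: exponential_density_nonneg)
  with distributed_affine[OF assms(2), of "1 / s" 0] \<open>s > 0\<close> show ?thesis
    by simp
qed

section \<open>The local modulus of continuity\<close>

text \<open>
  For nonnegative arguments the supremum is over a set that contains \<open>0\<close>, grows with the argument
  and is bounded as soon as \<open>g\<close> is.  The truncation \<open>max 0 t\<close> extends this monotone behaviour to
  the whole line, so that monotonicity yields Borel measurability.
\<close>

lemma
  assumes "x \<in> I" and "\<And>y. y \<in> I \<Longrightarrow> \<bar>g y - g x\<bar> \<le> K"
  shows le_local_modulus:
      "\<And>y t. y \<in> I \<Longrightarrow> \<bar>y - x\<bar> \<le> t \<Longrightarrow> \<bar>g y - g x\<bar> \<le> local_modulus I x g t"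
    and local_modulus_le: "\<And>t. t \<ge> 0 \<Longrightarrow> local_modulus I x g t \<le> K"
    and local_modulus_nonneg: "\<And>t. t \<ge> 0 \<Longrightarrow> local_modulus I x g t \<ge> 0"
    and mono_local_modulus: "mono (\<lambda>t. local_modulus I x g (max 0 t))"
    and borel_measurable_local_modulus: "local_modulus I x g \<in> borel_measurable borel"
proof -
  let ?S = "\<lambda>t. {\<bar>g (x + u) - g x\<bar> | u. x + u \<in> I \<and> \<bar>u\<bar> \<le> t}"
  have bdd: "bdd_above (?S t)" for t
    using assms(2) by (auto intro!: bdd_aboveI[of _ K])
  have ne: "0 \<in> ?S t" if "t \<ge> 0" for t
    using that \<open>x \<in> I\<close> by (auto intro!: exI[of _ 0])
  show le: "\<bar>g y - g x\<bar> \<le> local_modulus I x g t" if "y \<in> I" "\<bar>y - x\<bar> \<le> t" for y t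
    unfolding local_modulus_def
    using that by (intro cSup_upper[OF _ bdd]) (auto intro!: exI[of _ "y - x"])
  show "local_modulus I x g t \<le> K" if "t \<ge> 0" for t
    unfolding local_modulus_def
    using ne[OF that] assms(2) by (intro cSup_least) auto
  show "local_modulus I x g t \<ge> 0" if "t \<ge> 0" for t
    using le[OF \<open>x \<in> I\<close>, of t] that by simp
  show mono: "mono (\<lambda>t. local_modulus I x g (max 0 t))"
  proof (rule monoI)
    fix s t :: real assume "s \<le> t"
    then show "local_modulus I x g (max 0 s) \<le> local_modulus I x g (max 0 t)"
      unfolding local_modulus_def
      using ne[of "max 0 s"] by (intro cSup_subset_mono bdd) auto
  qed
  have neg: "?S t = {}" if "t < 0" for t
    using that by auto
  \<comment> \<open>At a negative argument the modulus is the supremum of the empty set: an unspecified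
    constant, which is harmless for measurability.\<close>
  have "local_modulus I x g = (\<lambda>t. if t < 0 then Sup {} else local_modulus I x g (max 0 t))"
  proof
    fix t show "local_modulus I x g t = (if t < 0 then Sup {} else local_modulus I x g (max 0 t))"
    proof (cases "t < 0")
      case True
      then show ?thesis by (simp only: local_modulus_def[of I x g t] neg if_True)
    qed (simp add: max_def)
  qed
  moreover have "(\<lambda>t. if t < 0 then Sup {} else local_modulus I x g (max 0 t)) \<in> borel_measurable borel"
    using borel_measurable_mono[OF mono] by measurable
  ultimately show "local_modulus I x g \<in> borel_measurable borel"
    by simp
qed

section \<open>Expansion of a primitive at a jump of its density\<close>

lemma abs_cont_on_imp_continuous_on:
  assumes "abs_cont_on I \<phi>"
  shows "continuous_on I \<phi>"
  unfolding continuous_on_iff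
  \<comment> \<open>Continuity is the case of a single interval.\<close>
proof (intro ballI allI impI)
  fix x e :: real assume "x \<in> I" "e > 0"
  then obtain d where "d > 0" and d: "\<And>(m::nat) a b.
        (\<forall>k<m. a k \<in> I \<and> b k \<in> I \<and> a k \<le> b k) \<Longrightarrow>
        disjoint_family_on (\<lambda>k. {a k<..<b k}) {..<m} \<Longrightarrow>
        (\<Sum>k<m. b k - a k) < d \<Longrightarrow> (\<Sum>k<m. \<bar>\<phi> (b k) - \<phi> (a k)\<bar>) < e"
    using assms unfolding abs_cont_on_def by meson
  have one: "\<bar>\<phi> q - \<phi> p\<bar> < e" if "p \<in> I" "q \<in> I" "p \<le> q" "q - p < d" for p q
    using d[of 1 "\<lambda>_. p" "\<lambda>_. q"] that by (simp add: disjoint_family_on_def)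
  have "dist (\<phi> y) (\<phi> x) < e" if "y \<in> I" "dist y x < d" for y
    using one[of x y] one[of y x] that \<open>x \<in> I\<close> by (cases "x \<le> y") (auto simp: dist_real_def)
  with \<open>d > 0\<close> show "\<exists>d>0. \<forall>y\<in>I. dist y x < d \<longrightarrow> dist (\<phi> y) (\<phi> x) < e"
    by blast
qed

text \<open>
  Two integrals meet here: the density \<open>f\<close> of the primitive is only Lebesgue measurable, whereas the
  comparison with an exponential law takes place under Borel measure.  They can be matched because the
  nonnegative integral does not change under completion of the measure.  The bound \<open>K\<close> makes \<open>f\<close>
  integrable, so that its integral is not the default value.
\<close>

lemma integral_deviation_from_constant:
  fixes f :: "real \<Rightarrow> real"
  assumes "f \<in> borel_measurable (lebesgue_on {p<..<q})" and "p \<le> q"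
    and "\<And>u. u \<in> {p<..<q} \<Longrightarrow> \<bar>f u\<bar> \<le> K"
    and "\<And>u. u \<in> {p<..<q} \<Longrightarrow> \<bar>f u - c\<bar> \<le> w u"
  shows "ennreal \<bar>(LINT u:{p<..<q}|lebesgue. f u) - c * (q - p)\<bar>
    \<le> (\<integral>\<^sup>+u. ennreal (w u) * indicator {p<..<q} u \<partial>lborel)"
proof -
  interpret finite_measure "lebesgue_on {p<..<q}"
    by (rule finite_measure_lebesgue_on) simp
  have i: "integrable (lebesgue_on {p<..<q}) f"
    using assms by (intro integrable_const_bound[where B = K]) (auto simp: AE_restrict_space_iff)
  have "(LINT u:{p<..<q}|lebesgue. f u) = (LINT u|lebesgue_on {p<..<q}. f u)"
    by (simp add: set_lebesgue_integral_def integral_restrict_space)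
  moreover have "(LINT u|lebesgue_on {p<..<q}. f u - c)
      = (LINT u|lebesgue_on {p<..<q}. f u) - c * (q - p)"
    using i \<open>p \<le> q\<close> by (simp add: measure_restrict_space)
  ultimately have "ennreal \<bar>(LINT u:{p<..<q}|lebesgue. f u) - c * (q - p)\<bar>
      = ennreal (norm (LINT u|lebesgue_on {p<..<q}. f u - c))" by simp
  also have "\<dots> \<le> (\<integral>\<^sup>+u. norm (f u - c) \<partial>lebesgue_on {p<..<q})"
    using i by (intro integral_norm_bound_ennreal) simp
  also have "\<dots> \<le> (\<integral>\<^sup>+u. ennreal (w u) \<partial>lebesgue_on {p<..<q})"
    using assms by (intro nn_integral_mono ennreal_leI) simp
  also have "\<dots> = (\<integral>\<^sup>+u. ennreal (w u) * indicator {p<..<q} u \<partial>lborel)"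
    by (simp add: nn_integral_restrict_space nn_integral_completion)
  finally show ?thesis .
qed

text \<open>
  Between \<open>x\<close> and \<open>y\<close> only one of the constants \<open>a\<close>, \<open>b\<close> matters, and the coefficients
  \<open>(a + b) / 2\<close> and \<open>(a - b) / 2\<close> select it according to the sign of \<open>y - x\<close>.  The substitution
  \<open>t = \<bar>u - x\<bar>\<close> brings the bounds of both sides to the same integral.
\<close>

lemma primitive_expansion_remainder:
  fixes I :: "real set" and x y :: real and f \<phi> W :: "real \<Rightarrow> real"
  assumes "is_interval I" and "x \<in> I" and "y \<in> I"
    and f: "f \<in> borel_measurable (lebesgue_on I)" "\<And>u. u \<in> I \<Longrightarrow> \<bar>f u\<bar> \<le> K"
    and \<phi>: "is_primitive I x f \<phi>"
    and [measurable]: "W \<in> borel_measurable borel"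
    and right: "\<And>u. u \<in> I \<Longrightarrow> u > x \<Longrightarrow> \<bar>f u - a\<bar> \<le> W (u - x)"
    and left: "\<And>u. u \<in> I \<Longrightarrow> u < x \<Longrightarrow> \<bar>f u - b\<bar> \<le> W (x - u)"
  shows "ennreal \<bar>\<phi> y - \<phi> x - (a + b) / 2 * (y - x) - (a - b) / 2 * \<bar>y - x\<bar>\<bar>
    \<le> (\<integral>\<^sup>+t. ennreal (W t) * indicator {0<..<\<bar>y - x\<bar>} t \<partial>lborel)"
proof (cases "x \<le> y")
  case True
  have sub: "{x<..<y} \<subseteq> I"
    by (auto intro: mem_is_interval_1_I[OF assms(1) \<open>x \<in> I\<close> \<open>y \<in> I\<close>])
  have "ennreal \<bar>(LINT u:{x<..<y}|lebesgue. f u) - a * (y - x)\<bar>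
      \<le> (\<integral>\<^sup>+u. ennreal (W (u - x)) * indicator {x<..<y} u \<partial>lborel)"
    using sub f right True
    by (intro integral_deviation_from_constant[where K = K] measurable_restrict_mono[OF f(1)]) auto
  also have "\<dots> = (\<integral>\<^sup>+t. ennreal (W t) * indicator {0<..<\<bar>y - x\<bar>} t \<partial>lborel)"
    using True by (subst nn_integral_real_affine[where c = 1 and t = x])
      (auto intro!: nn_integral_cong simp: indicator_def)
  also have "(LINT u:{x<..<y}|lebesgue. f u) = \<phi> y - \<phi> x"
    using \<phi> \<open>y \<in> I\<close> True by (simp add: is_primitive_def interval_lebesgue_integral_def)
  also have "\<phi> y - \<phi> x - a * (y - x)
      = \<phi> y - \<phi> x - (a + b) / 2 * (y - x) - (a - b) / 2 * \<bar>y - x\<bar>"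
    using True by (simp add: field_simps)
  finally show ?thesis .
next
  case False
  have sub: "{y<..<x} \<subseteq> I"
    by (auto intro: mem_is_interval_1_I[OF assms(1) \<open>y \<in> I\<close> \<open>x \<in> I\<close>])
  have "ennreal \<bar>(LINT u:{y<..<x}|lebesgue. f u) - b * (x - y)\<bar>
      \<le> (\<integral>\<^sup>+u. ennreal (W (x - u)) * indicator {y<..<x} u \<partial>lborel)"
    using sub f left False
    by (intro integral_deviation_from_constant[where K = K] measurable_restrict_mono[OF f(1)]) auto
  also have "\<dots> = (\<integral>\<^sup>+t. ennreal (W t) * indicator {0<..<\<bar>y - x\<bar>} t \<partial>lborel)"
    using False by (subst nn_integral_real_affine[where c = "-1" and t = x])
      (auto intro!: nn_integral_cong simp: indicator_def)
  also have "(LINT u:{y<..<x}|lebesgue. f u) = \<phi> x - \<phi> y"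
    using \<phi> \<open>y \<in> I\<close> False by (simp add: is_primitive_def interval_lebesgue_integral_def)
  also have "\<phi> x - \<phi> y - b * (x - y)
      = - (\<phi> y - \<phi> x - (a + b) / 2 * (y - x) - (a - b) / 2 * \<bar>y - x\<bar>)"
    using False by (simp add: field_simps)
  finally show ?thesis
    by (simp only: abs_minus_cancel)
qed

section \<open>The error estimate\<close>

theorem theorem3p4:
  fixes I :: "real set" and x :: real
    and M :: "nat \<Rightarrow> 'a measure" and Z :: "nat \<Rightarrow> real \<Rightarrow> 'a \<Rightarrow> real"
    and \<beta> :: real and C :: "nat \<Rightarrow> real \<Rightarrow> real"
    and N :: "'b measure" and X :: "'b \<Rightarrow> real"
    and \<phi> f g :: "real \<Rightarrow> real"
  assumes "is_interval I" and "x \<in> interior I"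
    and "\<And>n. n \<ge> 1 \<Longrightarrow> prob_space (M n)"
    and "\<And>n. n \<ge> 1 \<Longrightarrow> Z n x \<in> borel_measurable (M n)"
    and "\<And>n \<omega>. n \<ge> 1 \<Longrightarrow> \<omega> \<in> space (M n) \<Longrightarrow> x + Z n x \<omega> / sqrt (real n) \<in> I"
    and "\<beta> > 0" and "\<And>n. n \<ge> 1 \<Longrightarrow> C n \<beta> > 0"
    and "\<And>n \<theta>. n \<ge> 1 \<Longrightarrow> \<theta> \<ge> 0 \<Longrightarrow>
           measure (M n) {\<omega> \<in> space (M n). \<bar>Z n x \<omega>\<bar> \<ge> \<theta>} \<le> C n \<beta> * exp (- \<beta> * \<theta>)"
    and "(\<lambda>n. measure (M n) {\<omega> \<in> space (M n). Z n x \<omega> > 0}) \<longlonglongrightarrow> 1 / 2"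
    and "(\<lambda>n. measure (M n) {\<omega> \<in> space (M n). Z n x \<omega> < 0}) \<longlonglongrightarrow> 1 / 2"
    and "prob_space N" and "distributed N lborel X (exponential_density \<beta>)"
    and "\<phi> \<in> DB_space I x" and "f \<in> B_space I x" and "is_primitive I x f \<phi>"
    and "g = assoc_fun I x f"
  shows "\<forall>n\<ge>1.
    \<bar>L_op M Z n \<phi> x - \<phi> x
       - 1 / (2 * sqrt (real n)) * (right_lim f x + left_lim f x) * (\<integral>\<omega>. Z n x \<omega> \<partial>M n)
       - 1 / (2 * sqrt (real n)) * (right_lim f x - left_lim f x) * (\<integral>\<omega>. \<bar>Z n x \<omega>\<bar> \<partial>M n)\<bar>
    \<le> C n \<beta> / (\<beta> * sqrt (real n)) * (\<integral>\<omega>. local_modulus I x g (X \<omega> / sqrt (real n)) \<partial>N)"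
proof (intro allI impI)
  fix n :: nat assume n: "n \<ge> 1"
  define s where "s = sqrt (real n)"
  define a where "a = right_lim f x"
  define b where "b = left_lim f x"
  define W where "W t = local_modulus I x g (max 0 t)" for t
  define R where "R y = \<phi> y - \<phi> x - (a + b) / 2 * (y - x) - (a - b) / 2 * \<bar>y - x\<bar>" for y
  define Y where "Y \<omega> = x + Z n x \<omega> / s" for \<omega>
  have s: "s > 0" using n by (simp add: s_def)
  have x: "x \<in> I" using assms(2) interior_subset by blast
  interpret M: prob_space "M n" by (rule assms(3)[OF n])
  interpret N: prob_space N by fact
  have Zm [measurable]: "Z n x \<in> borel_measurable (M n)" by (rule assms(4)[OF n])
  have Xm [measurable]: "X \<in> borel_measurable N"
    using distributed_measurable[OF assms(12)] by simp
  have YI: "Y \<omega> \<in> I" if "\<omega> \<in> space (M n)" for \<omega>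
    using assms(5)[OF n that] by (simp add: Y_def s_def)
  obtain K where K: "\<And>u. u \<in> I \<Longrightarrow> \<bar>f u\<bar> \<le> K"
    using assms(14) by (auto simp: B_space_def bounded_iff)
  have g: "g x = 0" "\<And>u. u \<in> I \<Longrightarrow> u > x \<Longrightarrow> g u = f u - a" "\<And>u. u \<in> I \<Longrightarrow> u < x \<Longrightarrow> g u = f u - b"
    using assms(16) by (auto simp: assoc_fun_def a_def b_def)
  have gK: "\<bar>g u - g x\<bar> \<le> K + \<bar>a\<bar> + \<bar>b\<bar>" if "u \<in> I" for u
    using K[OF that] g that by (cases u x rule: linorder_cases) fastforce+
  note modulus = le_local_modulus[where g = g, OF x gK] local_modulus_le[where g = g, OF x gK]
    local_modulus_nonneg[where g = g, OF x gK] mono_local_modulus[where g = g, OF x gK]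
  have [measurable]: "local_modulus I x g \<in> borel_measurable borel"
    using borel_measurable_local_modulus[where g = g, OF x gK] .
  have Wm [measurable]: "W \<in> borel_measurable borel"
    unfolding W_def using modulus(4) by (rule borel_measurable_mono)
  have W: "0 \<le> W t" "W t \<le> K + \<bar>a\<bar> + \<bar>b\<bar>" for t
    using modulus(2,3)[of "max 0 t"] by (auto simp: W_def)
  \<comment> \<open>Dividing by \<open>s = \<surd>n\<close> multiplies the rate of decay by \<open>s\<close>.\<close>
  have tail: "measure (M n) {\<omega> \<in> space (M n). t \<le> \<bar>Y \<omega> - x\<bar>} \<le> C n \<beta> * exp (- (\<beta> * s) * t)"
    if "t \<ge> 0" for t
    using assms(8)[OF n, of "s * t"] that s
    by (simp add: Y_def abs_divide pos_le_divide_eq mult_ac)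
  have Ym [measurable]: "Y \<in> borel_measurable (M n)"
    unfolding Y_def by measurable
  have int_abs: "integrable (M n) (\<lambda>\<omega>. \<bar>Y \<omega> - x\<bar>)"
    using assms(6) assms(7)[OF n] s tail M.finite_measure_axioms
    by (intro exponential_tail_imp_integrable[where b = "\<beta> * s" and c = "C n \<beta>"]) auto
  then have int_Y: "integrable (M n) (\<lambda>\<omega>. Y \<omega> - x)"
    by (subst (asm) integrable_abs_iff) auto

  \<comment> \<open>The primitive is only controlled on \<open>I\<close>, so measurability of the composition has to use that
    \<open>Y\<close> takes its values there.\<close>
  have "continuous_on I \<phi>"
    using assms(13) by (simp add: DB_space_def abs_cont_on_imp_continuous_on)
  then have "\<phi> \<in> borel_measurable (restrict_space borel I)"
    by (rule borel_measurable_continuous_on_restrict)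
  moreover have "Y \<in> measurable (M n) (restrict_space borel I)"
    using YI by (intro measurable_restrict_space2) auto
  ultimately have [measurable]: "(\<lambda>\<omega>. \<phi> (Y \<omega>)) \<in> borel_measurable (M n)"
    by (rule measurable_compose[rotated])
  have [measurable]: "(\<lambda>\<omega>. R (Y \<omega>)) \<in> borel_measurable (M n)"
    unfolding R_def by measurable

  have pathwise: "ennreal \<bar>R (Y \<omega>)\<bar>
      \<le> (\<integral>\<^sup>+t. ennreal (W t) * indicator {0<..<\<bar>Y \<omega> - x\<bar>} t \<partial>lborel)" if "\<omega> \<in> space (M n)" for \<omega>
    unfolding R_def
  proof (rule primitive_expansion_remainder[OF assms(1) x YI[OF that] _ K assms(15) Wm])
    show "f \<in> borel_measurable (lebesgue_on I)"
      using assms(14) by (simp add: B_space_def)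
  next
    fix u assume "u \<in> I" "u > x"
    then show "\<bar>f u - a\<bar> \<le> W (u - x)"
      using modulus(1)[of u "u - x"] g by (simp add: W_def)
  next
    fix u assume "u \<in> I" "u < x"
    then show "\<bar>f u - b\<bar> \<le> W (x - u)"
      using modulus(1)[of u "x - u"] g by (simp add: W_def)
  qed
  have int_W: "integrable N (\<lambda>\<omega>. W (X \<omega> / s))"
    using W by (intro N.integrable_const_bound[where B = "K + \<bar>a\<bar> + \<bar>b\<bar>"]) auto
  have "(\<integral>\<^sup>+\<omega>. ennreal \<bar>R (Y \<omega>)\<bar> \<partial>M n)
      \<le> (\<integral>\<^sup>+\<omega>. (\<integral>\<^sup>+t. ennreal (W t) * indicator {0<..<\<bar>Y \<omega> - x\<bar>} t \<partial>lborel) \<partial>M n)"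
    by (intro nn_integral_mono pathwise)
  also have "\<dots> \<le> ennreal (C n \<beta> / (\<beta> * s))
      * (\<integral>\<^sup>+t. exponential_density (\<beta> * s) t * ennreal (W t) \<partial>lborel)"
    using assms(6) assms(7)[OF n] s tail M.finite_measure_axioms
    by (intro exponential_tail_integral) auto
  also have "(\<integral>\<^sup>+t. exponential_density (\<beta> * s) t * ennreal (W t) \<partial>lborel)
      = (\<integral>\<^sup>+\<omega>. ennreal (W (X \<omega> / s)) \<partial>N)"
    using distributed_exponential_divide[OF assms(11,12,6) s]
    by (rule distributed_nn_integral) measurable
  also have "\<dots> = ennreal (\<integral>\<omega>. W (X \<omega> / s) \<partial>N)"
    using W int_W by (intro nn_integral_eq_integral) auto
  also have "ennreal (C n \<beta> / (\<beta> * s)) * \<dots> = ennreal (C n \<beta> / (\<beta> * s) * (\<integral>\<omega>. W (X \<omega> / s) \<partial>N))"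
    using W assms(6) assms(7)[OF n] s by (intro ennreal_mult[symmetric]) auto
  finally have bound: "(\<integral>\<^sup>+\<omega>. ennreal \<bar>R (Y \<omega>)\<bar> \<partial>M n)
      \<le> ennreal (C n \<beta> / (\<beta> * s) * (\<integral>\<omega>. W (X \<omega> / s) \<partial>N))" .
  have int_R: "integrable (M n) (\<lambda>\<omega>. R (Y \<omega>))"
    using bound by (intro integrableI_bounded) (auto simp: le_less_trans)
  have "ennreal \<bar>\<integral>\<omega>. R (Y \<omega>) \<partial>M n\<bar> \<le> (\<integral>\<^sup>+\<omega>. ennreal \<bar>R (Y \<omega>)\<bar> \<partial>M n)"
    using integral_norm_bound_ennreal[OF int_R] by simp
  with bound have "ennreal \<bar>\<integral>\<omega>. R (Y \<omega>) \<partial>M n\<bar>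
      \<le> ennreal (C n \<beta> / (\<beta> * s) * (\<integral>\<omega>. W (X \<omega> / s) \<partial>N))"
    by simp
  moreover have "0 \<le> C n \<beta> / (\<beta> * s) * (\<integral>\<omega>. W (X \<omega> / s) \<partial>N)"
    using W assms(6) assms(7)[OF n] s by simp
  ultimately have main: "\<bar>\<integral>\<omega>. R (Y \<omega>) \<partial>M n\<bar> \<le> C n \<beta> / (\<beta> * s) * (\<integral>\<omega>. W (X \<omega> / s) \<partial>N)"
    by simp

  have "(\<integral>\<omega>. \<phi> (Y \<omega>) \<partial>M n)
      = (\<integral>\<omega>. \<phi> x + (a + b) / 2 * (Y \<omega> - x) + (a - b) / 2 * \<bar>Y \<omega> - x\<bar> + R (Y \<omega>) \<partial>M n)"
    by (intro Bochner_Integration.integral_cong) (simp_all add: R_def)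
  also have "\<dots> = \<phi> x + (a + b) / 2 * (\<integral>\<omega>. Y \<omega> - x \<partial>M n)
      + (a - b) / 2 * (\<integral>\<omega>. \<bar>Y \<omega> - x\<bar> \<partial>M n) + (\<integral>\<omega>. R (Y \<omega>) \<partial>M n)"
    using int_abs int_Y int_R
    by (simp add: M.prob_space del: Bochner_Integration.integral_diff)
  finally have "(\<integral>\<omega>. R (Y \<omega>) \<partial>M n) = (\<integral>\<omega>. \<phi> (Y \<omega>) \<partial>M n) - \<phi> x
      - (a + b) / 2 * (\<integral>\<omega>. Y \<omega> - x \<partial>M n) - (a - b) / 2 * (\<integral>\<omega>. \<bar>Y \<omega> - x\<bar> \<partial>M n)"
    by simp
  moreover have "(\<integral>\<omega>. Y \<omega> - x \<partial>M n) = (\<integral>\<omega>. Z n x \<omega> \<partial>M n) / s"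
    by (simp add: Y_def)
  moreover have "(\<integral>\<omega>. \<bar>Y \<omega> - x\<bar> \<partial>M n) = (\<integral>\<omega>. \<bar>Z n x \<omega>\<bar> \<partial>M n) / s"
    using s by (simp add: Y_def abs_divide)
  moreover have "(\<integral>\<omega>. \<phi> (Y \<omega>) \<partial>M n) = L_op M Z n \<phi> x"
    by (simp add: L_op_def Y_def s_def)
  ultimately have R_eq: "(\<integral>\<omega>. R (Y \<omega>) \<partial>M n) = L_op M Z n \<phi> x - \<phi> x
       - 1 / (2 * s) * (a + b) * (\<integral>\<omega>. Z n x \<omega> \<partial>M n)
       - 1 / (2 * s) * (a - b) * (\<integral>\<omega>. \<bar>Z n x \<omega>\<bar> \<partial>M n)"
    by simp

  have "AE \<omega> in N. X \<omega> \<ge> 0"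
    by (subst N.distributed_AE2[OF assms(12)]) (auto simp: exponential_density_def)
  then have AE: "AE \<omega> in N. W (X \<omega> / s) = local_modulus I x g (X \<omega> / s)"
    by eventually_elim (use s in \<open>simp add: W_def max_def\<close>)
  have "(\<integral>\<omega>. W (X \<omega> / s) \<partial>N) = (\<integral>\<omega>. local_modulus I x g (X \<omega> / s) \<partial>N)"
    by (intro integral_cong_AE AE) measurable
  with main R_eq show "\<bar>L_op M Z n \<phi> x - \<phi> x
       - 1 / (2 * sqrt (real n)) * (right_lim f x + left_lim f x) * (\<integral>\<omega>. Z n x \<omega> \<partial>M n)
       - 1 / (2 * sqrt (real n)) * (right_lim f x - left_lim f x) * (\<integral>\<omega>. \<bar>Z n x \<omega>\<bar> \<partial>M n)\<bar>
    \<le> C n \<beta> / (\<beta> * sqrt (real n)) * (\<integral>\<omega>. local_modulus I x g (X \<omega> / sqrt (real n)) \<partial>N)"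
    by (simp only: s_def a_def b_def)
qed

end
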